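(* Let $\mathcal{A}$ be an antichain of graphs under the induced subgraph ordering. Then $\mathcal{A}$ is minimal if and only if $\mathrm{Free}(\mathcal{A})$ is a boundary class.
   Context: Graphs are finite and simple, considered up to isomorphism, and ordered by the induced subgraph relation. A (hereditary) class of graphs is a collection of graphs closed under taking induced subgraphs; $\mathrm{Free}(\mathcal{A})$ is the class of all graphs containing no member of $\mathcal{A}$ as an induced subgraph. A class is well-quasi-ordered if it contains no infinite antichain. Minimal antichains: for infinite antichains $\mathcal{A},\mathcal{B}$ of graphs write $\mathcal{A}\preceq\mathcal{B}$ if for every $B\in\mathcal{B}$ there is $A\in\mathcal{A}$ such that $A$ is an induced subgraph of $B$. An antichain $\mathcal{A}$ is minimal if it is infinite and it is minimal under $\preceq$ among infinite antichains. Limit and boundary classes: a class $\mathcal{C}$ is a limit class if there is a sequence of classes $\mathcal{C}_1\supseteq\mathcal{C}_2\supseteq\cdots$ (inclusions not necessarily strict), none of which is well-quasi-ordered, with $\mathcal{C}=\bigcap_{i=1}^\infty\mathcal{C}_i$. A boundary class is a limit class that is minimal under inclusion among limit classes, i.e. no proper subclass of it is a limit class. *)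

theory Defs
  imports "Graph_Theory.Pair_Digraph" "Graph_Theory.Digraph_Isomorphism"
begin

text \<open>A finite simple graph is a finite, loopless, symmetric digraph without parallel arcs, that is,
  a \<^const>\<open>pair_graph\<close>.  Every such graph is isomorphic to one whose vertices are natural numbers, so
  fixing the vertex type to \<^typ>\<open>nat\<close> loses no isomorphism class.  The graph without vertices is
  included.\<close>

definition graph_iso :: "nat pair_pre_digraph \<Rightarrow> nat pair_pre_digraph \<Rightarrow> bool" where
  "graph_iso G H \<longleftrightarrow> pair_graph G \<and> pair_graph H \<and> digraph_iso (with_proj G) (with_proj H)"

lemma pair_graph_wf: "pair_graph G \<Longrightarrow> wf_digraph (with_proj G)"
  by (simp add: wf_digraph_wp_iff pair_graph_def pair_digraph_def pair_fin_digraph_def)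

lemma digraph_iso_refl: "wf_digraph G \<Longrightarrow> digraph_iso G G"
  unfolding digraph_iso_def
  by (rule exI[of _ "\<lparr>iso_verts = id, iso_arcs = id, iso_head = head G, iso_tail = tail G\<rparr>"])
     (simp add: app_iso_def pre_digraph.digraph_isomorphism_def)

lemma graph_iso_refl: "pair_graph G \<Longrightarrow> graph_iso G G"
  by (simp add: graph_iso_def digraph_iso_refl pair_graph_wf)

lemma graph_iso_sym: "graph_iso G H \<Longrightarrow> graph_iso H G"
  by (simp add: graph_iso_def digraph_iso_swap pair_graph_wf)

lemma graph_iso_trans: "graph_iso G H \<Longrightarrow> graph_iso H K \<Longrightarrow> graph_iso G K"
  by (auto simp: graph_iso_def intro: digraph_iso_trans)

lemma part_equivp_graph_iso: "part_equivp graph_iso"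
proof (rule part_equivpI)
  have "pair_graph (\<lparr>pverts = {}, parcs = {}\<rparr> :: nat pair_pre_digraph)"
    by unfold_locales (auto simp: symmetric_def sym_def)
  then show "\<exists>G. graph_iso G G"
    using graph_iso_refl by blast
  show "symp graph_iso"
    using graph_iso_sym by (rule sympI)
  show "transp graph_iso"
    using graph_iso_trans by (rule transpI)
qed

quotient_type ugraph = "nat pair_pre_digraph" / partial: graph_iso
  by (rule part_equivp_graph_iso)

lemma digraph_iso_induced_subgraph:
  assumes "digraph_iso H H'" "induced_subgraph K H"
  obtains K' where "induced_subgraph K' H'" "digraph_iso K K'"
proof -
  from assms(1) obtain f where f: "pre_digraph.digraph_isomorphism H f" "H' = app_iso f H"
    by (auto simp: digraph_iso_def)
  have sub: "subgraph K H"
    using assms(2) by (simp add: induced_subgraph_def)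
  interpret H: wf_digraph H
    using f(1) by (simp add: pre_digraph.digraph_isomorphism_def)
  have K: "pre_digraph.digraph_isomorphism K f"
    using f(1) sub by (rule pre_digraph.digraph_isomorphism_subgraphI)
  show thesis
  proof
    show "digraph_iso K (app_iso f K)"
      using K by (auto simp: digraph_iso_def)
    have "subgraph (app_iso f K) H'"
      using H.subgraph_app_isoI[OF f(1) sub] f(2) by simp
    moreover have "arcs (app_iso f K)
        = {e \<in> arcs H'. tail H' e \<in> verts (app_iso f K) \<and> head H' e \<in> verts (app_iso f K)}"
    proof -
      have inj: "inj_on (iso_verts f) (verts H)"
        and tl: "\<And>a. a \<in> arcs H \<Longrightarrow> iso_tail f (iso_arcs f a) = iso_verts f (tail H a)"
        and hd: "\<And>a. a \<in> arcs H \<Longrightarrow> iso_head f (iso_arcs f a) = iso_verts f (head H a)"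
        using f(1) by (auto simp: H.digraph_isomorphism_def)
      have vs: "verts K \<subseteq> verts H"
        using sub by (simp add: subgraph_def)
      have mem: "iso_verts f v \<in> iso_verts f ` verts K \<longleftrightarrow> v \<in> verts K" if "v \<in> verts H" for v
        by (rule inj_on_image_mem_iff[OF inj that vs])
      have "arcs K = {e \<in> arcs H. tail H e \<in> verts K \<and> head H e \<in> verts K}"
        using assms(2) by (simp add: induced_subgraph_def)
      also have "\<dots> = {e \<in> arcs H. iso_verts f (tail H e) \<in> iso_verts f ` verts K
          \<and> iso_verts f (head H e) \<in> iso_verts f ` verts K}"
        by (simp add: mem cong: conj_cong)
      finally have "arcs (app_iso f K) = iso_arcs f ` \<dots>"
        by simp
      also have "\<dots> = {e \<in> arcs H'. tail H' e \<in> verts (app_iso f K)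
          \<and> head H' e \<in> verts (app_iso f K)}"
        unfolding f(2) app_iso_simps using tl hd by fastforce
      finally show ?thesis .
    qed
    ultimately show "induced_subgraph (app_iso f K) H'"
      by (simp add: induced_subgraph_def)
  qed
qed

lift_definition induced_le :: "ugraph \<Rightarrow> ugraph \<Rightarrow> bool" is
  "\<lambda>G H. \<exists>K. induced_subgraph K (with_proj H) \<and> digraph_iso (with_proj G) K"
proof -
  have imp: "\<exists>K'. induced_subgraph K' (with_proj H') \<and> digraph_iso (with_proj G') K'"
    if G: "graph_iso G G'" and H: "graph_iso H H'"
      and ex: "\<exists>K. induced_subgraph K (with_proj H) \<and> digraph_iso (with_proj G) K" for G G' H H'
  proof -
    from ex obtain K where K: "induced_subgraph K (with_proj H)" "digraph_iso (with_proj G) K"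
      by blast
    obtain K' where "induced_subgraph K' (with_proj H')" "digraph_iso K K'"
      using digraph_iso_induced_subgraph H K(1) unfolding graph_iso_def by blast
    moreover have "digraph_iso (with_proj G') (with_proj G)"
      using graph_iso_sym[OF G] by (simp add: graph_iso_def)
    ultimately show ?thesis
      using K(2) digraph_iso_trans by blast
  qed
  show "(\<exists>K. induced_subgraph K (with_proj H) \<and> digraph_iso (with_proj G) K)
      \<longleftrightarrow> (\<exists>K. induced_subgraph K (with_proj H') \<and> digraph_iso (with_proj G') K)"
    if "graph_iso G G'" "graph_iso H H'" for G G' H H'
    using imp[OF that] imp[OF that(1)[THEN graph_iso_sym] that(2)[THEN graph_iso_sym]] by blast
qed

definition antichain :: "ugraph set \<Rightarrow> bool" where
  "antichain A \<longleftrightarrow> (\<forall>G\<in>A. \<forall>H\<in>A. induced_le G H \<longrightarrow> G = H)"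

definition hereditary :: "ugraph set \<Rightarrow> bool" where
  "hereditary C \<longleftrightarrow> (\<forall>H\<in>C. \<forall>G. induced_le G H \<longrightarrow> G \<in> C)"

definition Free :: "ugraph set \<Rightarrow> ugraph set" where
  "Free A = {G. \<forall>H\<in>A. \<not> induced_le H G}"

definition wqo_class :: "ugraph set \<Rightarrow> bool" where
  "wqo_class C \<longleftrightarrow> (\<nexists>A. A \<subseteq> C \<and> antichain A \<and> infinite A)"

definition antichain_le :: "ugraph set \<Rightarrow> ugraph set \<Rightarrow> bool" where
  "antichain_le A B \<longleftrightarrow> (\<forall>H\<in>B. \<exists>G\<in>A. induced_le G H)"

definition minimal_antichain :: "ugraph set \<Rightarrow> bool" where
  "minimal_antichain A \<longleftrightarrow> antichain A \<and> infinite A \<and>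
    (\<forall>B. antichain B \<and> infinite B \<and> antichain_le B A \<longrightarrow> antichain_le A B)"

definition limit_class :: "ugraph set \<Rightarrow> bool" where
  "limit_class C \<longleftrightarrow> (\<exists>D :: nat \<Rightarrow> ugraph set.
    (\<forall>i. hereditary (D i) \<and> \<not> wqo_class (D i)) \<and> decseq D \<and> C = (\<Inter>i. D i))"

definition boundary_class :: "ugraph set \<Rightarrow> bool" where
  "boundary_class C \<longleftrightarrow> limit_class C \<and> (\<nexists>D. limit_class D \<and> D \<subset> C)"

end

theory Submission
  imports Defs "HOL-Library.Countable_Set"
begin

text \<open>Only three facts about graphs matter: the induced subgraph relation is reflexive, it is
  transitive, and there are only countably many graphs, so that the members of an infinite
  antichain can be forbidden one after the other.

  Countability makes \<open>C \<inter> Free B\<close> a limit class whenever \<open>B\<close> is an infinite antichain inside the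
  hereditary class \<open>C\<close>: forbidding only the first \<open>k\<close> members of \<open>B\<close> leaves the rest of \<open>B\<close> in
  the class (\<open>limit_class_Int_Free\<close>).  In particular \<open>Free B\<close> is a limit class, and a boundary class
  is well-quasi-ordered, since otherwise forbidding an infinite antichain in it would give a
  smaller limit class.  In the other direction, a limit class omits a finite set \<open>F\<close> only if
  \<open>Free F\<close> is not well-quasi-ordered (\<open>limit_class_not_wqo_Free\<close>).

  If \<open>Free A\<close> is a boundary class, then it is well-quasi-ordered and omits \<open>A\<close>, so \<open>A\<close> is infinite.
  An infinite antichain \<open>B\<close> with \<open>antichain_le B A\<close> gives a limit class \<open>Free B \<subseteq> Free A\<close>; the
  boundary property forces equality, which yields \<open>antichain_le A B\<close>.

  If \<open>A\<close> is minimal, an exchange argument shows that \<open>Free A\<close> is well-quasi-ordered and that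
  each \<open>G \<in> Free A\<close> is contained in all but finitely many members of \<open>A\<close>.  A limit class strictly
  inside \<open>Free A\<close> would omit some such \<open>G\<close> together with the finitely many members of \<open>A\<close> that
  do not contain \<open>G\<close>.  But forbidding this finite set forbids all of \<open>A\<close>, so it leaves a
  well-quasi-ordered class.\<close>

section \<open>The induced subgraph relation on isomorphism classes\<close>

lemma pair_graph_rep_ugraph: "pair_graph (rep_ugraph G)"
  using Quotient3_rep_reflp[OF Quotient3_ugraph] by (auto simp: graph_iso_def)

lemma induced_le_refl: "induced_le G G"
proof -
  have "wf_digraph (with_proj (rep_ugraph G))"
    by (simp add: pair_graph_rep_ugraph pair_graph_wf)
  then show ?thesis
    unfolding induced_le.rep_eq
    by (meson digraph_iso_refl wf_digraph.induced_subgraph_refl)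
qed

lemma induced_subgraph_trans:
  assumes "induced_subgraph G H" "induced_subgraph H K"
  shows "induced_subgraph G K"
proof -
  have "subgraph G K"
    using assms subgraph_trans by (auto simp: induced_subgraph_def)
  moreover have "tail G = tail H" "head G = head H" "tail H = tail K" "head H = head K"
      "verts G \<subseteq> verts H"
    using assms by (auto simp: induced_subgraph_def subgraph_def compatible_def)
  ultimately show ?thesis
    using assms unfolding induced_subgraph_def by auto
qed

lemma induced_le_trans:
  assumes "induced_le G H" "induced_le H K"
  shows "induced_le G K"
proof -
  obtain H' where H': "induced_subgraph H' (with_proj (rep_ugraph K))"
      "digraph_iso (with_proj (rep_ugraph H)) H'"
    using assms(2) by (auto simp: induced_le.rep_eq)
  obtain G' where G': "induced_subgraph G' (with_proj (rep_ugraph H))"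
      "digraph_iso (with_proj (rep_ugraph G)) G'"
    using assms(1) by (auto simp: induced_le.rep_eq)
  obtain G'' where G'': "induced_subgraph G'' H'" "digraph_iso G' G''"
    using digraph_iso_induced_subgraph[OF H'(2) G'(1)] by blast
  have "induced_subgraph G'' (with_proj (rep_ugraph K))"
    using G''(1) H'(1) by (rule induced_subgraph_trans)
  then show ?thesis
    unfolding induced_le.rep_eq using G'(2) G''(2) digraph_iso_trans by blast
qed

lemma countable_ugraph_set: "countable (A :: ugraph set)"
proof -
  let ?code = "\<lambda>G. (pverts (rep_ugraph G), parcs (rep_ugraph G))"
  have "inj ?code"
  proof (rule injI)
    fix G H assume "?code G = ?code H"
    then have "rep_ugraph G = rep_ugraph H"
      by (intro pair_pre_digraph.equality) auto
    then show "G = H"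
      using Quotient3_abs_rep[OF Quotient3_ugraph] by metis
  qed
  moreover have "countable (range ?code)"
  proof (rule countable_subset)
    have "pair_fin_digraph (rep_ugraph G)" for G
      using pair_graph_rep_ugraph by (simp add: pair_graph_def pair_pseudo_graph_def)
    then show "range ?code \<subseteq> Collect finite \<times> Collect finite"
      by (auto simp: pair_fin_digraph_def pair_fin_digraph_axioms_def)
    show "countable (Collect finite \<times> Collect finite :: (nat set \<times> (nat \<times> nat) set) set)"
      by (intro countable_SIGMA countable_Collect_finite)
  qed
  ultimately show ?thesis
    using countable_subset[OF subset_UNIV countable_image_inj_on] by blast
qed

section \<open>Limit classes\<close>

lemma hereditary_Free: "hereditary (Free A)"
  unfolding hereditary_def Free_def using induced_le_trans by blast

lemma hereditary_Int: "hereditary C \<Longrightarrow> hereditary D \<Longrightarrow> hereditary (C \<inter> D)"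
  by (auto simp: hereditary_def)

lemma wqo_class_mono: "wqo_class D \<Longrightarrow> C \<subseteq> D \<Longrightarrow> wqo_class C"
  unfolding wqo_class_def by blast

lemma disjoint_Free: "A \<inter> Free A = {}"
  using induced_le_refl by (auto simp: Free_def)

lemma antichain_diff_subset_Free:
  assumes "antichain A" "F \<subseteq> A"
  shows "A - F \<subseteq> Free F"
  using assms by (auto simp: antichain_def Free_def)

lemma antichain_le_iff: "antichain_le A B \<longleftrightarrow> B \<inter> Free A = {}"
  by (auto simp: antichain_le_def Free_def)

lemma hereditary_subset_Free:
  assumes "hereditary C" "A \<inter> C = {}"
  shows "C \<subseteq> Free A"
  using assms by (auto simp: hereditary_def Free_def)

text \<open>Forbid the elements of \<open>B\<close> successively: at each stage all but finitely many of them remain,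
  and they are what keeps the stage from being well-quasi-ordered.\<close>

lemma limit_class_Int_Free:
  assumes "hereditary C" "antichain B" "infinite B" "B \<subseteq> C"
  shows "limit_class (C \<inter> Free B)"
proof -
  let ?F = "\<lambda>k. from_nat_into B ` {..<k}"
  let ?D = "\<lambda>k. C \<inter> Free (?F k)"
  have range_eq: "range (from_nat_into B) = B"
    using assms(3) countable_ugraph_set by (intro range_from_nat_into) auto
  have "hereditary (?D k)" for k
    by (intro hereditary_Int hereditary_Free assms(1))
  moreover have "\<not> wqo_class (?D k)" for k
  proof -
    have "?F k \<subseteq> B"
      using range_eq by auto
    then have "B - ?F k \<subseteq> ?D k"
      using antichain_diff_subset_Free[OF assms(2)] assms(4) by blast
    moreover have "antichain (B - ?F k)"
      using assms(2) by (auto simp: antichain_def)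
    moreover have "infinite (B - ?F k)"
      using assms(3) by (intro Diff_infinite_finite) auto
    ultimately show ?thesis
      unfolding wqo_class_def by blast
  qed
  moreover have "decseq ?D"
    by (auto simp: decseq_def Free_def)
  moreover have "C \<inter> Free B = (\<Inter>k. ?D k)"
  proof -
    have "(\<Union>k. ?F k) = B"
      unfolding image_UN[symmetric] UN_lessThan_UNIV range_eq ..
    moreover have "Free (\<Union>k. ?F k) = (\<Inter>k. Free (?F k))"
      by (auto simp: Free_def)
    ultimately show ?thesis
      by auto
  qed
  ultimately show ?thesis
    unfolding limit_class_def by (intro exI[of _ ?D]) simp
qed

corollary limit_class_Free: "antichain B \<Longrightarrow> infinite B \<Longrightarrow> limit_class (Free B)"
  using limit_class_Int_Free[of UNIV B] by (simp add: hereditary_def)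

lemma boundary_class_wqo:
  assumes "boundary_class C" "hereditary C"
  shows "wqo_class C"
proof (rule ccontr)
  assume "\<not> wqo_class C"
  then obtain B where B: "B \<subseteq> C" "antichain B" "infinite B"
    by (auto simp: wqo_class_def)
  then have "limit_class (C \<inter> Free B)"
    using assms(2) limit_class_Int_Free by blast
  moreover have "C \<inter> Free B \<subset> C"
    using B(1) infinite_imp_nonempty[OF B(3)] disjoint_Free[of B] by blast
  ultimately show False
    using assms(1) unfolding boundary_class_def by blast
qed

text \<open>A finite set that misses the intersection of a decreasing sequence misses some term of the
  sequence already, so that term lies in \<open>Free F\<close>.\<close>

lemma limit_class_not_wqo_Free:
  assumes "limit_class L" "finite F" "F \<inter> L = {}"
  shows "\<not> wqo_class (Free F)"
proof -
  obtain D :: "nat \<Rightarrow> ugraph set" where D: "\<forall>i. hereditary (D i) \<and> \<not> wqo_class (D i)" "decseq D"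
      and L: "L = (\<Inter>i. D i)"
    using assms(1) unfolding limit_class_def by (elim exE conjE) (rule that)
  have "\<exists>n. F \<inter> D n = {}"
    using assms(2,3) unfolding L
  proof (induction F)
    case empty
    show ?case by simp
  next
    case (insert x F)
    then obtain m n where "x \<notin> D m" "F \<inter> D n = {}"
      by auto
    moreover have "D (max m n) \<subseteq> D m" "D (max m n) \<subseteq> D n"
      using D(2) by (auto simp: decseq_def)
    ultimately have "insert x F \<inter> D (max m n) = {}"
      by blast
    then show ?case ..
  qed
  then obtain n where "D n \<subseteq> Free F"
    using D(1) hereditary_subset_Free by meson
  then show ?thesis
    using D(1) wqo_class_mono by blast
qed

section \<open>Minimal antichains\<close>

text \<open>Adding an antichain \<open>C\<close> of \<open>Free A\<close> to \<open>A\<close>, and discarding the members of \<open>A\<close> above \<open>C\<close>,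
  produces an antichain below \<open>A\<close> that \<open>A\<close> is not below.  Minimality leaves only the possibility
  that the result is finite.\<close>

lemma minimal_antichain_exchange:
  assumes "minimal_antichain A" "antichain C" "C \<subseteq> Free A" "C \<noteq> {}"
  shows "finite (C \<union> (A \<inter> Free C))"
proof (rule ccontr)
  let ?B = "C \<union> (A \<inter> Free C)"
  assume "infinite ?B"
  moreover have "antichain ?B"
    using assms(1-3) by (auto simp: minimal_antichain_def antichain_def Free_def)
  moreover have "antichain_le ?B A"
    using induced_le_refl by (auto simp: antichain_le_def Free_def)
  ultimately have "antichain_le A ?B"
    using assms(1) by (auto simp: minimal_antichain_def)
  then show False
    using assms(3,4) by (auto simp: antichain_le_iff)
qed

lemma minimal_antichain_wqo_Free:
  assumes "minimal_antichain A"
  shows "wqo_class (Free A)"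
proof (rule ccontr)
  assume "\<not> wqo_class (Free A)"
  then obtain C where "C \<subseteq> Free A" "antichain C" "infinite C"
    by (auto simp: wqo_class_def)
  then show False
    using minimal_antichain_exchange[OF assms, of C] by auto
qed

lemma minimal_antichain_finite_avoiding:
  assumes "minimal_antichain A" "G \<in> Free A"
  shows "finite (A \<inter> Free {G})"
  using minimal_antichain_exchange[OF assms(1), of "{G}"] assms(2) by (auto simp: antichain_def)

lemma minimal_antichain_imp_boundary_class:
  assumes "minimal_antichain A"
  shows "boundary_class (Free A)"
proof -
  have "limit_class (Free A)"
    using assms limit_class_Free by (simp add: minimal_antichain_def)
  moreover have False if L: "limit_class L" "L \<subset> Free A" for L
  proof -
    obtain G where G: "G \<in> Free A" "G \<notin> L"
      using L(2) by blast
    \<comment> \<open>Forbidding \<open>G\<close> together with these finitely many members of \<open>A\<close> forbids all of \<open>A\<close>.\<close>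
    let ?F = "insert G (A \<inter> Free {G})"
    have "finite ?F"
      using minimal_antichain_finite_avoiding[OF assms G(1)] by simp
    moreover have "?F \<inter> L = {}"
      using G(2) L(2) disjoint_Free[of A] by blast
    ultimately have "\<not> wqo_class (Free ?F)"
      using limit_class_not_wqo_Free[OF L(1)] by blast
    moreover have "Free ?F \<subseteq> Free A"
    proof (rule hereditary_subset_Free[OF hereditary_Free])
      show "A \<inter> Free ?F = {}"
        using induced_le_refl by (auto simp: Free_def)
    qed
    ultimately show False
      using minimal_antichain_wqo_Free[OF assms] wqo_class_mono by blast
  qed
  ultimately show ?thesis
    unfolding boundary_class_def by blast
qed

lemma boundary_class_imp_minimal_antichain:
  assumes "antichain A" "boundary_class (Free A)"
  shows "minimal_antichain A"
proof -
  have "infinite A"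
  proof
    assume "finite A"
    then have "\<not> wqo_class (Free A)"
      using limit_class_not_wqo_Free assms(2) disjoint_Free[of A]
      unfolding boundary_class_def by blast
    then show False
      using boundary_class_wqo[OF assms(2) hereditary_Free] by contradiction
  qed
  moreover have "antichain_le A B" if B: "antichain B" "infinite B" "antichain_le B A" for B
  proof -
    have "Free B \<subseteq> Free A"
      using B(3) by (intro hereditary_subset_Free hereditary_Free) (simp add: antichain_le_iff)
    then have "Free B = Free A"
      using assms(2) limit_class_Free[OF B(1,2)] unfolding boundary_class_def by blast
    then show ?thesis
      using disjoint_Free[of B] by (simp add: antichain_le_iff)
  qed
  ultimately show ?thesis
    using assms(1) by (simp add: minimal_antichain_def)
qed

theorem theorem3p5:
  fixes A :: "ugraph set"
  assumes "antichain A"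
  shows "minimal_antichain A \<longleftrightarrow> boundary_class (Free A)"
  using assms minimal_antichain_imp_boundary_class boundary_class_imp_minimal_antichain by blast

end
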